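(* (1) There exists an absolute constant $c>0$ such that for every $n\geq 1$ and every Boolean function $f:\{-1,1\}^n\to\{0,1\}$ there exists a halfspace $g:\{-1,1\}^n\to\{0,1\}$ such that $$\mathrm{Cov}(f,g)\;\ge\; c\sqrt{\frac{W^1(f)}{\log(e/W^1(f))}}.$$ (2) In particular, for every $c_0>0$ there exists $c'>0$ (depending only on $c_0$) such that for every $n\ge1$ and every $f:\{-1,1\}^n\to\{0,1\}$ with $\mathbb{E}[f]\le\frac12$ and $W^1(f)\ge c_0\,\mathbb{E}[f]^2\log(1/\mathbb{E}[f])$ (i.e. $f$ is Fourier noise resistant with constant $c_0$), there exists a halfspace $g$ with $\mathrm{Cov}(f,g)\ge c'\,\mathbb{E}[f]$.
   Context: Expectations are with respect to the uniform measure on $\{-1,1\}^n$; $\mathrm{Cov}(f,g)=\mathbb{E}[fg]-\mathbb{E}[f]\mathbb{E}[g]$; $\hat f(\{i\})=\mathbb{E}[f(x)x_i]$ and $W^1(f)=\sum_i\hat f(\{i\})^2$. A halfspace is a function of the form $g(x)=\mathbf{1}\left(\sum_i a_ix_i>t\right)$ with $a\in\mathbb{R}^n$, $t\in\mathbb{R}$. $\log$ is the natural logarithm. The right-hand side in (1) is interpreted as $0$ if $W^1(f)=0$, and $\mathbb{E}[f]^2\log(1/\mathbb{E}[f])$ is interpreted as $0$ if $\mathbb{E}[f]=0$. *)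

theory Defs
  imports "HOL-Probability.Probability"
begin

text \<open>Coordinates are indexed by \<open>0, \<dots>, n - 1\<close>; the functions on the cube considered below
  have type \<open>(nat \<Rightarrow> real) \<Rightarrow> real\<close>, and only their values on \<open>cube n\<close> matter.\<close>

definition cube :: "nat \<Rightarrow> (nat \<Rightarrow> real) set" where
  "cube n = {..<n} \<rightarrow>\<^sub>E {-1, 1}"

definition expect :: "nat \<Rightarrow> ((nat \<Rightarrow> real) \<Rightarrow> real) \<Rightarrow> real" where
  "expect n f = measure_pmf.expectation (pmf_of_set (cube n)) f"

definition Cov :: "nat \<Rightarrow> ((nat \<Rightarrow> real) \<Rightarrow> real) \<Rightarrow> ((nat \<Rightarrow> real) \<Rightarrow> real) \<Rightarrow> real" where
  "Cov n f g = expect n (\<lambda>x. f x * g x) - expect n f * expect n g"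

definition fourier1 :: "nat \<Rightarrow> ((nat \<Rightarrow> real) \<Rightarrow> real) \<Rightarrow> nat \<Rightarrow> real" where
  "fourier1 n f i = expect n (\<lambda>x. f x * x i)"

definition W1 :: "nat \<Rightarrow> ((nat \<Rightarrow> real) \<Rightarrow> real) \<Rightarrow> real" where
  "W1 n f = (\<Sum>i<n. (fourier1 n f i)\<^sup>2)"

definition halfspace :: "nat \<Rightarrow> ((nat \<Rightarrow> real) \<Rightarrow> real) \<Rightarrow> bool" where
  "halfspace n g \<longleftrightarrow> (\<exists>(a :: nat \<Rightarrow> real) (t :: real). \<forall>x\<in>cube n.
     g x = of_bool ((\<Sum>i<n. a i * x i) > t))"

definition fourier_noise_resistant :: "nat \<Rightarrow> real \<Rightarrow> ((nat \<Rightarrow> real) \<Rightarrow> real) \<Rightarrow> bool" where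
  "fourier_noise_resistant n c\<^sub>0 f \<longleftrightarrow>
     W1 n f \<ge> c\<^sub>0 * (if expect n f = 0 then 0 else (expect n f)\<^sup>2 * ln (1 / expect n f))"

end

theory Submission
  imports Defs
begin

text \<open>
  Write \<open>w\<close> for \<open>W1 n f\<close>, let \<open>a\<close> be the unit vector along the degree-one Fourier coefficients of
  \<open>f\<close>, and let \<open>X = (\<Sum>i<n. a i * x i)\<close>. By Plancherel the linear form \<open>X\<close> has covariance \<open>sqrt w\<close>
  with \<open>f\<close> (\<open>Cov_level1_direction\<close>). A linear form is not a halfspace, but it is a superposition
  of them: after truncation to \<open>[-T, T]\<close> it equals, up to the constant \<open>T\<close>, the integral over
  \<open>t \<in> [-T, T]\<close> of the indicators of \<open>X > t\<close>. Covariance is linear, so the truncated form has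
  covariance with \<open>f\<close> at most \<open>2 * T\<close> times the supremum of those of the halfspaces
  (\<open>Cov_clip_le\<close>).

  It remains to choose \<open>T\<close> so that truncation loses at most half of \<open>sqrt w\<close>. Since \<open>f\<close> is
  Boolean, the loss is at most the mean of the part of \<open>\<bar>X\<bar>\<close> above \<open>T\<close>, which is of order
  \<open>exp (- T\<^sup>2 / 2)\<close> because \<open>X\<close> is subgaussian (\<open>expect_clip_error_le\<close>). So \<open>T\<close> of order
  \<open>sqrt (ln (exp 1 / w))\<close> suffices, and some halfspace has covariance of order
  \<open>sqrt w / T\<close> (\<open>correlating_halfspace\<close>). This is the first claim.

  For the second claim let \<open>\<mu>\<close> be the mean of \<open>f\<close>. Noise resistance says that \<open>w\<close> is at least of
  order \<open>\<mu>\<^sup>2 * ln (1 / \<mu>)\<close>, and then \<open>ln (exp 1 / w)\<close> is at most of order \<open>ln (1 / \<mu>)\<close>; the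
  two logarithms cancel and \<open>sqrt (w / ln (exp 1 / w))\<close> is at least of order \<open>\<mu>\<close>
  (\<open>W1_log_lower_bound\<close>).
\<close>

section \<open>Expectations over the cube\<close>

lemma finite_cube [simp]: "finite (cube n)"
  and cube_nonempty [simp]: "cube n \<noteq> {}"
  and card_cube: "card (cube n) = 2 ^ n"
  by (auto simp: cube_def PiE_eq_empty_iff card_PiE simp flip: numeral_2_eq_2 intro!: finite_PiE)

lemma expect_eq_average: "expect n f = (\<Sum>x\<in>cube n. f x) / 2 ^ n"
  by (simp add: expect_def integral_pmf_of_set card_cube)

lemma expect_const [simp]: "expect n (\<lambda>x. c) = c"
  by (simp add: expect_eq_average card_cube)

lemma expect_add: "expect n (\<lambda>x. f x + g x) = expect n f + expect n g"
  by (simp add: expect_eq_average sum.distrib add_divide_distrib)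

lemma expect_diff: "expect n (\<lambda>x. f x - g x) = expect n f - expect n g"
  by (simp add: expect_eq_average sum_subtractf diff_divide_distrib)

lemma expect_cmult: "expect n (\<lambda>x. c * f x) = c * expect n f"
  by (simp add: expect_eq_average sum_distrib_left)

lemma expect_sum: "expect n (\<lambda>x. \<Sum>i\<in>I. f i x) = (\<Sum>i\<in>I. expect n (f i))"
  unfolding expect_eq_average by (subst sum.swap) (simp add: sum_divide_distrib)

lemma expect_mono: "(\<And>x. x \<in> cube n \<Longrightarrow> f x \<le> g x) \<Longrightarrow> expect n f \<le> expect n g"
  unfolding expect_eq_average by (intro divide_right_mono sum_mono) auto

text \<open>This is the independence of the coordinates.\<close>

lemma expect_prod:
  "expect n (\<lambda>x. \<Prod>i<n. h i (x i)) = (\<Prod>i<n. (h i 1 + h i (-1)) / 2)"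
proof -
  have "(\<Prod>i<n. h i 1 + h i (-1)) = (\<Prod>i<n. \<Sum>y\<in>{-1, 1}. h i y)"
    by (simp add: add.commute)
  also have "\<dots> = (\<Sum>x\<in>cube n. \<Prod>i<n. h i (x i))"
    unfolding cube_def by (rule prod_sum_PiE) auto
  finally show ?thesis
    by (simp add: expect_eq_average prod_dividef)
qed

lemma expect_coordinate:
  assumes "i < n"
  shows "expect n (\<lambda>x. x i) = 0"
proof -
  \<comment> \<open>A coordinate is itself a product of one-variable functions, all but one equal to 1.\<close>
  have "expect n (\<lambda>x. \<Prod>j<n. if j = i then x j else 1) =
        (\<Prod>j<n. ((if j = i then 1 else 1) + (if j = i then -1 else 1)) / 2)"
    by (rule expect_prod)
  also have "\<dots> = 0"
    using assms by (auto intro!: prod_zero)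
  also have "(\<lambda>x. \<Prod>j<n. if j = i then x j else 1) = (\<lambda>x :: nat \<Rightarrow> real. x i)"
    using assms by (simp add: prod.delta)
  finally show ?thesis .
qed

section \<open>Covariance\<close>

lemma Cov_eq_centred: "Cov n f g = expect n (\<lambda>x. (f x - expect n f) * g x)"
  by (simp add: Cov_def left_diff_distrib expect_diff expect_cmult)

lemma Cov_diff_right: "Cov n f (\<lambda>x. g x - h x) = Cov n f g - Cov n f h"
  by (simp add: Cov_eq_centred right_diff_distrib expect_diff)

lemma expect_boolean_bounds:
  assumes "f \<in> cube n \<rightarrow> {0, 1}"
  shows "0 \<le> expect n f" "expect n f \<le> 1"
proof -
  have "f x = 0 \<or> f x = 1" if "x \<in> cube n" for x
    using assms that by (auto simp: Pi_iff)
  then show "0 \<le> expect n f" "expect n f \<le> 1"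
    using expect_mono[of n "\<lambda>x. 0" f] expect_mono[of n f "\<lambda>x. 1"] by fastforce+
qed

text \<open>The centred function \<open>f - expect n f\<close> takes values in \<open>[-1, 1]\<close>. The bound controls what
  \<open>f\<close> can lose when a linear form is truncated.\<close>

lemma Cov_boolean_le:
  assumes f: "f \<in> cube n \<rightarrow> {0, 1}"
  shows "Cov n f g \<le> expect n (\<lambda>x. \<bar>g x\<bar>)"
  unfolding Cov_eq_centred
proof (rule expect_mono)
  fix x assume "x \<in> cube n"
  with f have "\<bar>f x - expect n f\<bar> \<le> 1"
    using expect_boolean_bounds[OF f] by (auto simp: Pi_iff)
  then have "\<bar>(f x - expect n f) * g x\<bar> \<le> 1 * \<bar>g x\<bar>"
    unfolding abs_mult by (intro mult_right_mono) auto
  then show "(f x - expect n f) * g x \<le> \<bar>g x\<bar>"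
    by linarith
qed

section \<open>Linear forms are subgaussian\<close>

text \<open>This is Hoeffding's lemma for a uniform sign. The library's analytic core of that lemma
  bounds \<open>- h * p + ln (1 + p * (exp h - 1))\<close> for \<open>h \<ge> 0\<close>; at \<open>p = 1/2\<close> and \<open>h = 2 * \<bar>x\<bar>\<close> this
  expression is \<open>ln (cosh x)\<close>.\<close>

lemma cosh_le_exp_half_square: "cosh x \<le> exp (x\<^sup>2 / 2)" for x :: real
proof -
  have "- (2 * \<bar>x\<bar>) * (1/2) + ln (1 + 1/2 * (exp (2 * \<bar>x\<bar>) - 1)) \<le> (2 * \<bar>x\<bar>)\<^sup>2 / 8"
    by (rule Hoeffdings_lemma_aux) auto
  then have "ln (1 + 1/2 * (exp (2 * \<bar>x\<bar>) - 1)) \<le> x\<^sup>2 / 2 + \<bar>x\<bar>"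
    by (simp add: power_mult_distrib)
  then have "exp (ln (1 + 1/2 * (exp (2 * \<bar>x\<bar>) - 1))) \<le> exp (x\<^sup>2 / 2 + \<bar>x\<bar>)"
    by simp
  then have "1 + 1/2 * (exp (2 * \<bar>x\<bar>) - 1) \<le> exp (x\<^sup>2 / 2 + \<bar>x\<bar>)"
    by (subst (asm) exp_ln) (auto simp: add_pos_nonneg)
  moreover have "1 + 1/2 * (exp (2 * \<bar>x\<bar>) - 1) = exp \<bar>x\<bar> * cosh x"
    by (cases "x \<ge> 0") (simp_all add: cosh_def field_simps flip: exp_add)
  ultimately have "exp \<bar>x\<bar> * cosh x \<le> exp \<bar>x\<bar> * exp (x\<^sup>2 / 2)"
    by (simp add: exp_add mult.commute)
  then show ?thesis by simp
qed

lemma expect_exp_linear_le: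
  "expect n (\<lambda>x. exp (\<Sum>i<n. a i * x i)) \<le> exp ((\<Sum>i<n. (a i)\<^sup>2) / 2)"
proof -
  have "expect n (\<lambda>x. exp (\<Sum>i<n. a i * x i)) = expect n (\<lambda>x. \<Prod>i<n. exp (a i * x i))"
    by (simp add: exp_sum)
  also have "\<dots> = (\<Prod>i<n. cosh (a i))"
    by (simp add: expect_prod[of n "\<lambda>i y. exp (a i * y)"] cosh_def)
  also have "\<dots> \<le> (\<Prod>i<n. exp ((a i)\<^sup>2 / 2))"
    by (intro prod_mono) (auto simp: cosh_le_exp_half_square)
  also have "\<dots> = exp ((\<Sum>i<n. (a i)\<^sup>2) / 2)"
    by (simp add: sum_divide_distrib flip: exp_sum)
  finally show ?thesis .
qed

lemma expect_cosh_linear_le: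
  "expect n (\<lambda>x. cosh (\<Sum>i<n. a i * x i)) \<le> exp ((\<Sum>i<n. (a i)\<^sup>2) / 2)"
proof -
  have "expect n (\<lambda>x. cosh (\<Sum>i<n. a i * x i)) =
        expect n (\<lambda>x. 1/2 * exp (\<Sum>i<n. a i * x i) + 1/2 * exp (\<Sum>i<n. - a i * x i))"
    by (simp add: cosh_def sum_negf field_simps)
  also have "\<dots> \<le> exp ((\<Sum>i<n. (a i)\<^sup>2) / 2)"
    unfolding expect_add expect_cmult
    using expect_exp_linear_le[of n a] expect_exp_linear_le[of n "\<lambda>i. - a i"] by simp
  finally show ?thesis .
qed

section \<open>Truncation and thresholds\<close>

text \<open>\<open>clip T y\<close> is the point of \<open>[-T, T]\<close> nearest to \<open>y\<close>, for \<open>T \<ge> 0\<close>.\<close>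

definition clip :: "real \<Rightarrow> real \<Rightarrow> real" where
  "clip T y = max (- T) (min T y)"

text \<open>Chernoff's method applied to the mean excess over \<open>T\<close>: that excess is dominated pointwise by
  a multiple of \<open>cosh (\<lambda> * X)\<close>, whose mean is at most \<open>exp (\<lambda>\<^sup>2 / 2)\<close>. The exponent
  \<open>\<lambda>\<^sup>2 / 2 - \<lambda> * T\<close> is smallest at \<open>\<lambda> = T\<close>.\<close>

lemma expect_clip_error_le:
  assumes T: "T > 0" and a: "(\<Sum>i<n. (a i)\<^sup>2) \<le> 1"
  shows "expect n (\<lambda>x. \<bar>(\<Sum>i<n. a i * x i) - clip T (\<Sum>i<n. a i * x i)\<bar>)
           \<le> 2 * exp (- T\<^sup>2 / 2) / T"
proof -
  have "\<bar>y - clip T y\<bar> \<le> 2 * exp (- T\<^sup>2) / T * cosh (T * y)" for y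
  proof -
    have "\<bar>y - clip T y\<bar> = max 0 (\<bar>y\<bar> - T)"
      using T by (auto simp: clip_def max_def min_def)
    also have "\<dots> \<le> exp (T * (\<bar>y\<bar> - T)) / T"
    proof -
      have "T * (\<bar>y\<bar> - T) \<le> exp (T * (\<bar>y\<bar> - T))"
        using exp_ge_add_one_self[of "T * (\<bar>y\<bar> - T)"] by linarith
      then show ?thesis
        using T by (simp add: field_simps)
    qed
    also have "\<dots> = exp (- T\<^sup>2) / T * exp (T * \<bar>y\<bar>)"
      by (simp add: right_diff_distrib power2_eq_square flip: exp_add)
    also have "\<dots> \<le> exp (- T\<^sup>2) / T * (2 * cosh (T * y))"
      using T by (intro mult_left_mono) (cases "y \<ge> 0"; simp add: cosh_def)+
    finally show ?thesis by (simp add: mult_ac)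
  qed
  moreover have "T * (\<Sum>i<n. a i * x i) = (\<Sum>i<n. T * a i * x i)" for x
    by (simp add: sum_distrib_left mult.assoc)
  ultimately have "expect n (\<lambda>x. \<bar>(\<Sum>i<n. a i * x i) - clip T (\<Sum>i<n. a i * x i)\<bar>)
      \<le> 2 * exp (- T\<^sup>2) / T * expect n (\<lambda>x. cosh (\<Sum>i<n. T * a i * x i))"
    by (subst expect_cmult[symmetric], intro expect_mono) metis
  also have "\<dots> \<le> 2 * exp (- T\<^sup>2) / T * exp ((\<Sum>i<n. (T * a i)\<^sup>2) / 2)"
    using T by (intro mult_left_mono expect_cosh_linear_le) auto
  also have "\<dots> \<le> 2 * exp (- T\<^sup>2) / T * exp (T\<^sup>2 / 2)"
  proof -
    have "(\<Sum>i<n. (T * a i)\<^sup>2) = T\<^sup>2 * (\<Sum>i<n. (a i)\<^sup>2)"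
      by (simp add: power_mult_distrib sum_distrib_left)
    also have "\<dots> \<le> T\<^sup>2"
      using a by (simp add: mult_left_le)
    finally show ?thesis
      using T by (intro mult_left_mono) auto
  qed
  also have "\<dots> = 2 * exp (- T\<^sup>2 / 2) / T"
    by (simp flip: exp_add)
  finally show ?thesis .
qed

text \<open>The layer-cake formula: the thresholds \<open>t \<in> [-T, T]\<close> below \<open>y\<close> form, up to an endpoint, the
  interval from \<open>- T\<close> to \<open>clip T y\<close>.\<close>

lemma has_integral_threshold:
  assumes "T \<ge> 0"
  shows "((\<lambda>t. of_bool (y > t)) has_integral (clip T y + T)) {- T..T}"
proof -
  have "((\<lambda>t. 1) has_integral (clip T y - (- T)) * 1) {- T..clip T y}"
    using has_integral_const_real[of 1 "- T" "clip T y"] assms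
    by (auto simp: clip_def max_def min_def split: if_splits)
  then have "((\<lambda>t. if t \<in> {- T..clip T y} then 1 else 0) has_integral clip T y + T) {- T..T}"
    using assms by (subst has_integral_restrict) (auto simp: clip_def)
  moreover have "of_bool (y > t) = (if t \<in> {- T..clip T y} then 1 else 0)"
    if "t \<in> {- T..T} - {clip T y}" for t :: real
    using that assms by (auto simp: clip_def max_def min_def split: if_splits)
  \<comment> \<open>The two integrands differ at most at \<open>t = clip T y\<close>.\<close>
  ultimately show ?thesis
    using has_integral_spike_finite[of "{clip T y}" "{- T..T}" "\<lambda>t. of_bool (y > t)"
        "\<lambda>t. if t \<in> {- T..clip T y} then 1 else 0" "clip T y + T"]
    by blast
qed

text \<open>Averaging over thresholds. In contrapositive form: a large covariance with a truncated
  function \<open>X\<close> forces a large covariance with one of its superlevel sets.\<close>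

lemma Cov_clip_le:
  assumes T: "T \<ge> 0"
    and bound: "\<And>t. Cov n f (\<lambda>x. of_bool (X x > t)) \<le> \<delta>"
  shows "Cov n f (\<lambda>x. clip T (X x)) \<le> 2 * T * \<delta>"
proof -
  have Cov_eq_sum: "Cov n f h = (\<Sum>x\<in>cube n. (f x - expect n f) / 2 ^ n * h x)" for h
    unfolding Cov_eq_centred expect_eq_average[of n "\<lambda>x. (f x - expect n f) * h x"]
    by (simp add: sum_divide_distrib)
  have int_Cov: "((\<lambda>t. Cov n f (\<lambda>x. of_bool (X x > t))) has_integral
      Cov n f (\<lambda>x. clip T (X x) + T)) {- T..T}"
    unfolding Cov_eq_sum
    using T by (intro has_integral_sum has_integral_mult_right has_integral_threshold) auto
  have shift: "Cov n f (\<lambda>x. clip T (X x) + T) = Cov n f (\<lambda>x. clip T (X x))"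
  proof -
    have "expect n (\<lambda>x. f x * T) = expect n f * T"
      using expect_cmult[of n T f] by (simp add: mult.commute)
    then show ?thesis
      by (simp add: Cov_def distrib_left expect_add)
  qed
  have int_const: "((\<lambda>t. \<delta>) has_integral 2 * T * \<delta>) {- T..T}"
    using has_integral_const_real[of \<delta> "- T" T] T by simp
  show ?thesis
    using has_integral_le[OF int_Cov int_const] bound unfolding shift by blast
qed

section \<open>The normalised level-one part\<close>

lemma Cov_linear: "Cov n f (\<lambda>x. \<Sum>i<n. a i * x i) = (\<Sum>i<n. a i * fourier1 n f i)"
proof -
  have "expect n (\<lambda>x. \<Sum>i<n. a i * x i) = 0"
    by (simp add: expect_sum expect_cmult expect_coordinate)
  moreover have "expect n (\<lambda>x. f x * (\<Sum>i<n. a i * x i)) = (\<Sum>i<n. a i * fourier1 n f i)"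
    by (simp add: sum_distrib_left mult.left_commute expect_sum expect_cmult fourier1_def)
  ultimately show ?thesis
    by (simp add: Cov_def)
qed

lemma W1_nonneg: "W1 n f \<ge> 0"
  by (simp add: W1_def sum_nonneg)

definition level1_direction :: "nat \<Rightarrow> ((nat \<Rightarrow> real) \<Rightarrow> real) \<Rightarrow> nat \<Rightarrow> real" where
  "level1_direction n f i = fourier1 n f i / sqrt (W1 n f)"

lemma level1_direction_norm:
  assumes "W1 n f \<noteq> 0"
  shows "(\<Sum>i<n. (level1_direction n f i)\<^sup>2) = 1"
  using assms W1_nonneg[of n f]
  by (simp add: level1_direction_def power_divide flip: sum_divide_distrib W1_def)

lemma Cov_level1_direction:
  "Cov n f (\<lambda>x. \<Sum>i<n. level1_direction n f i * x i) = sqrt (W1 n f)"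
proof -
  have "(\<Sum>i<n. level1_direction n f i * fourier1 n f i) = W1 n f / sqrt (W1 n f)"
    by (simp add: level1_direction_def power2_eq_square W1_def sum_divide_distrib)
  then show ?thesis
    by (simp add: Cov_linear real_div_sqrt W1_nonneg)
qed

text \<open>A case of Bessel's inequality, obtained here from the subgaussian bound: the linear form has
  mean zero, so replacing \<open>f\<close> by \<open>f - 1/2\<close>, of absolute value \<open>1/2\<close>, leaves the covariance
  \<open>sqrt (W1 n f)\<close> unchanged and bounds it by half the mean of \<open>\<bar>X\<bar> \<le> cosh X\<close>. The bound makes
  \<open>ln (exp 1 / W1 n f)\<close> at least 1.\<close>

lemma W1_le_1:
  assumes f: "f \<in> cube n \<rightarrow> {0, 1}"
  shows "W1 n f \<le> 1"
proof (cases "W1 n f = 0")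
  case False
  let ?X = "\<lambda>x. \<Sum>i<n. level1_direction n f i * x i"
  have "expect n ?X = 0"
    by (simp add: expect_sum expect_cmult expect_coordinate)
  then have "sqrt (W1 n f) = expect n (\<lambda>x. f x * ?X x) - 1/2 * expect n ?X"
    using Cov_level1_direction[of n f] by (simp add: Cov_def)
  also have "\<dots> = expect n (\<lambda>x. f x * ?X x - 1/2 * ?X x)"
    by (simp only: expect_diff expect_cmult)
  also have "\<dots> \<le> expect n (\<lambda>x. 1/2 * cosh (?X x))"
  proof (rule expect_mono)
    fix x assume "x \<in> cube n"
    then have "f x = 0 \<or> f x = 1"
      using f by (auto simp: Pi_iff)
    then have "f x * y - 1/2 * y \<le> 1/2 * \<bar>y\<bar>" for y
      by auto
    moreover have "\<bar>y\<bar> \<le> cosh y" for y :: real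
    proof -
      have "2 * \<bar>y\<bar> \<le> 1 + \<bar>y\<bar> + \<bar>y\<bar>\<^sup>2 / 2"
        using zero_le_power2[of "\<bar>y\<bar> - 1"] unfolding power2_diff by simp
      also have "\<dots> \<le> exp \<bar>y\<bar>"
        by (rule exp_lower_Taylor_quadratic) simp
      also have "\<dots> \<le> 2 * cosh \<bar>y\<bar>"
        by (simp add: cosh_def)
      finally show ?thesis by simp
    qed
    ultimately have "f x * y - 1/2 * y \<le> 1/2 * cosh y" for y
      by (meson mult_left_mono order_trans half_gt_zero_iff less_imp_le zero_less_one)
    then show "f x * ?X x - 1/2 * ?X x \<le> 1/2 * cosh (?X x)" .
  qed
  also have "\<dots> \<le> 1/2 * exp (1/2)"
    unfolding expect_cmult
    using expect_cosh_linear_le[of n "level1_direction n f"] level1_direction_norm[OF False]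
    by simp
  also have "\<dots> \<le> 1"
    using exp_bound[of "1/2"] by (simp add: power2_eq_square)
  finally show ?thesis by simp
qed simp

section \<open>The correlating halfspace\<close>

lemma ln_exp1_div_W1_ge_1:
  assumes "f \<in> cube n \<rightarrow> {0, 1}" "W1 n f \<noteq> 0"
  shows "ln (exp 1 / W1 n f) \<ge> 1"
  using assms W1_nonneg[of n f] W1_le_1[OF assms(1)] by (auto simp: ln_div)

lemma halfspace_threshold: "halfspace n (\<lambda>x. of_bool ((\<Sum>i<n. a i * x i) > t))"
  unfolding halfspace_def by blast

lemma halfspace_zero: "halfspace n (\<lambda>x. 0)"
  using halfspace_threshold[where a = "\<lambda>i. 0" and t = 0] by simp

text \<open>If every threshold of the level-one form had covariance at most \<open>\<delta>\<close>, then the form truncated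
  at \<open>T = 2 * sqrt L\<close> would have covariance at most \<open>2 * T * \<delta> = sqrt w / 4\<close>. But truncation
  costs only \<open>exp (- T\<^sup>2 / 2) = (w / exp 1)\<^sup>2 \<le> sqrt w / 2\<close> of the covariance \<open>sqrt w\<close>. The constant
  \<open>1/16\<close> is half of what these estimates permit, which makes the contradiction strict.\<close>

lemma correlating_halfspace:
  assumes f: "f \<in> cube n \<rightarrow> {0, 1}" and w: "W1 n f \<noteq> 0"
  shows "\<exists>g. halfspace n g \<and> Cov n f g \<ge> 1/16 * sqrt (W1 n f / ln (exp 1 / W1 n f))"
proof (rule ccontr)
  define w where "w = W1 n f"
  define L where "L = ln (exp 1 / w)"
  define T where "T = 2 * sqrt L"
  define \<delta> where "\<delta> = 1/16 * sqrt (w / L)"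
  let ?X = "\<lambda>x. \<Sum>i<n. level1_direction n f i * x i"
  assume "\<not> ?thesis"
  then have small: "Cov n f (\<lambda>x. of_bool (?X x > t)) \<le> \<delta>" for t
    using halfspace_threshold unfolding \<delta>_def L_def w_def by (meson linear)
  have w01: "0 < w" "w \<le> 1" and L: "L \<ge> 1"
    using w W1_nonneg[of n f] W1_le_1[OF f] ln_exp1_div_W1_ge_1[OF f w] by (auto simp: w_def L_def)
  have T: "T \<ge> 2"
    using L by (simp add: T_def)
  have expL: "exp (- L) = w / exp 1"
    using w01 by (simp add: L_def exp_minus)
  have "Cov n f ?X - Cov n f (\<lambda>x. clip T (?X x)) = Cov n f (\<lambda>x. ?X x - clip T (?X x))"
    by (simp add: Cov_diff_right)
  also have "\<dots> \<le> expect n (\<lambda>x. \<bar>?X x - clip T (?X x)\<bar>)"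
    by (rule Cov_boolean_le[OF f])
  also have "\<dots> \<le> 2 * exp (- T\<^sup>2 / 2) / T"
    using T level1_direction_norm[OF w] by (intro expect_clip_error_le) auto
  also have "\<dots> \<le> exp (- T\<^sup>2 / 2)"
    using T by (simp add: field_simps)
  also have "\<dots> = (w / exp 1)\<^sup>2"
    using L by (simp add: T_def power_mult_distrib flip: expL exp_double)
  also have "\<dots> \<le> sqrt w / 2"
  proof -
    have "(w / exp 1)\<^sup>2 \<le> (sqrt w)\<^sup>2 * w / 2"
      using w01 exp_ge_add_one_self[of 1] mult_mono[of 2 "exp 1" 1 "exp (1::real)"]
      by (simp add: power2_eq_square field_simps)
    also have "(sqrt w)\<^sup>2 * w / 2 \<le> sqrt w * 1 * 1 / 2"
      unfolding power2_eq_square using w01 by (intro divide_right_mono mult_mono) auto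
    finally show ?thesis by simp
  qed
  finally have "sqrt w / 2 \<le> Cov n f (\<lambda>x. clip T (?X x))"
    by (simp add: Cov_level1_direction w_def)
  also have "\<dots> \<le> 2 * T * \<delta>"
    using T small by (intro Cov_clip_le) auto
  also have "\<dots> = sqrt w / 4"
    using L by (simp add: T_def \<delta>_def real_sqrt_divide)
  finally show False
    using w01 by simp
qed

text \<open>Here \<open>w\<close> stands for the level-one weight and \<open>\<mu>\<close> for the mean. With \<open>l = ln (1 / \<mu>)\<close>, the
  lower bound \<open>k * \<mu>\<^sup>2 * l\<close> on \<open>w\<close> gives \<open>ln (exp 1 / w) \<le> 1 + ln (1 / k) + 2 * l - ln l\<close>. As
  \<open>\<mu> \<le> 1/2\<close> keeps \<open>l\<close> away from 0, all four terms are bounded by multiples of \<open>l\<close>, and \<open>l\<close>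
  cancels in the quotient. The assumption \<open>k \<le> 1\<close> makes \<open>ln (1 / k)\<close> nonnegative.\<close>

lemma W1_log_lower_bound:
  assumes \<mu>: "0 < \<mu>" "\<mu> \<le> 1/2" and k: "0 < k" "k \<le> (1::real)"
    and w: "w \<ge> k * (\<mu>\<^sup>2 * ln (1 / \<mu>))" and w1: "w \<le> 1"
  shows "w / ln (exp 1 / w) \<ge> k / (6 + 2 * ln (1 / k)) * \<mu>\<^sup>2"
proof -
  define l where "l = ln (1 / \<mu>)"
  have "1/2 \<le> ln (2::real)"
    using ln2_ge_two_thirds by simp
  also have "\<dots> \<le> l"
    unfolding l_def using \<mu> by (intro ln_mono) (simp_all add: le_divide_eq)
  finally have l: "1/2 \<le> l" .
  have lower: "0 < k * (\<mu>\<^sup>2 * l)"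
    using k \<mu> l by simp
  then have w0: "0 < w"
    using w unfolding l_def by linarith
  have ln_mu: "ln \<mu> = - l"
    using \<mu> by (simp add: l_def ln_div)
  have "ln (exp 1 / w) \<le> ln (exp 1 / (k * (\<mu>\<^sup>2 * l)))"
    using w w0 lower by (simp add: l_def frac_le)
  also have "\<dots> = 1 + ln (1 / k) + 2 * l - ln l"
    using k \<mu> l by (simp add: ln_mu ln_div ln_mult ln_realpow)
  also have "\<dots> \<le> (6 + 2 * ln (1 / k)) * l"
  proof -
    have "ln (1 / l) \<le> 1 / l - 1"
      using l by (intro ln_le_minus_one) auto
    then have "1 - ln l \<le> 1 / l"
      using l by (simp add: ln_div)
    also have "\<dots> \<le> 4 * l"
    proof -
      have "1 \<le> (2 * l) * (2 * l)"
        using mult_mono[of 1 "2 * l" 1 "2 * l"] l by simp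
      then show ?thesis using l by (simp add: field_simps)
    qed
    finally have "1 - ln l \<le> 4 * l" .
    moreover have "ln (1 / k) * 1 \<le> ln (1 / k) * (2 * l)"
      using k l by (intro mult_left_mono) auto
    ultimately show ?thesis by (simp add: algebra_simps)
  qed
  finally have denom: "ln (exp 1 / w) \<le> (6 + 2 * ln (1 / k)) * l" .
  have "0 < ln (exp 1 / w)"
  proof -
    have "ln (exp 1 / w) = 1 - ln w"
      using w0 by (simp add: ln_div)
    then show ?thesis
      using ln_less_self[OF w0] w1 by linarith
  qed
  have "k / (6 + 2 * ln (1 / k)) * \<mu>\<^sup>2 = k * (\<mu>\<^sup>2 * l) / ((6 + 2 * ln (1 / k)) * l)"
    using l by simp
  also have "\<dots> \<le> w / ln (exp 1 / w)"
    using w w0 denom \<open>0 < ln (exp 1 / w)\<close> by (intro frac_le) (auto simp: l_def)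
  finally show ?thesis .
qed

lemma constant_correlation_of_noise_resistant:
  assumes f: "f \<in> cube n \<rightarrow> {0, 1}" and mean: "expect n f \<le> 1/2"
    and resistant: "fourier_noise_resistant n c f" and k: "0 < k" "k \<le> 1" "k \<le> c"
  shows "\<exists>g. halfspace n g \<and> Cov n f g \<ge> 1/16 * sqrt (k / (6 + 2 * ln (1 / k))) * expect n f"
proof (cases "expect n f = 0")
  case True
  then show ?thesis
    by (intro exI[of _ "\<lambda>x. 0"]) (simp add: Cov_def halfspace_zero)
next
  case False
  define \<mu> where "\<mu> = expect n f"
  have \<mu>: "0 < \<mu>" "\<mu> \<le> 1/2"
    using False mean expect_boolean_bounds[OF f] by (auto simp: \<mu>_def)
  have pos: "0 < \<mu>\<^sup>2 * ln (1 / \<mu>)"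
    using \<mu> by simp
  have "k * (\<mu>\<^sup>2 * ln (1 / \<mu>)) \<le> c * (\<mu>\<^sup>2 * ln (1 / \<mu>))"
    using pos k by (intro mult_right_mono) auto
  also have "\<dots> \<le> W1 n f"
    using resistant False by (simp add: fourier_noise_resistant_def \<mu>_def)
  finally have w: "k * (\<mu>\<^sup>2 * ln (1 / \<mu>)) \<le> W1 n f" .
  then have "W1 n f \<noteq> 0"
    using mult_pos_pos[OF k(1) pos] by linarith
  then obtain g where g: "halfspace n g"
      "Cov n f g \<ge> 1/16 * sqrt (W1 n f / ln (exp 1 / W1 n f))"
    using correlating_halfspace[OF f] by blast
  have "sqrt (k / (6 + 2 * ln (1 / k))) * \<mu> = sqrt (k / (6 + 2 * ln (1 / k)) * \<mu>\<^sup>2)"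
    using \<mu> by (simp only: real_sqrt_mult real_sqrt_abs abs_of_pos)
  also have "\<dots> \<le> sqrt (W1 n f / ln (exp 1 / W1 n f))"
    using W1_log_lower_bound[OF \<mu> k(1,2) w W1_le_1[OF f]] by simp
  finally show ?thesis
    using g by (intro exI[of _ g]) (simp add: \<mu>_def)
qed

theorem theorem1p8:
  shows "(\<exists>c>0::real. \<forall>n\<ge>1. \<forall>f \<in> cube n \<rightarrow> {0, 1}. \<exists>g. halfspace n g \<and>
           Cov n f g \<ge> c * (if W1 n f = 0 then 0 else sqrt (W1 n f / ln (exp 1 / W1 n f))))
       \<and> (\<forall>c\<^sub>0>0::real. \<exists>c'>0::real. \<forall>n\<ge>1. \<forall>f \<in> cube n \<rightarrow> {0, 1}.
           expect n f \<le> 1 / 2 \<and> fourier_noise_resistant n c\<^sub>0 f \<longrightarrow>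
           (\<exists>g. halfspace n g \<and> Cov n f g \<ge> c' * expect n f))"
proof (intro conjI allI impI)
  have "\<exists>g. halfspace n g \<and> Cov n f g \<ge>
      1/16 * (if W1 n f = 0 then 0 else sqrt (W1 n f / ln (exp 1 / W1 n f)))"
    if f: "f \<in> cube n \<rightarrow> {0, 1}" for n f
  proof (cases "W1 n f = 0")
    case True
    then show ?thesis
      by (intro exI[of _ "\<lambda>x. 0"]) (simp add: Cov_def halfspace_zero)
  qed (use correlating_halfspace[OF f] in simp)
  then show "\<exists>c>0::real. \<forall>n\<ge>1. \<forall>f \<in> cube n \<rightarrow> {0, 1}. \<exists>g. halfspace n g \<and>
      Cov n f g \<ge> c * (if W1 n f = 0 then 0 else sqrt (W1 n f / ln (exp 1 / W1 n f)))"
    by (intro exI[of _ "1/16"]) auto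
next
  fix c\<^sub>0 :: real assume c\<^sub>0: "c\<^sub>0 > 0"
  \<comment> \<open>A large \<open>c\<^sub>0\<close> is lowered to 1, so that \<open>ln (1 / k)\<close> is nonnegative.\<close>
  define k where "k = min 1 c\<^sub>0"
  have k: "0 < k" "k \<le> 1" "k \<le> c\<^sub>0"
    using c\<^sub>0 by (auto simp: k_def)
  then have "0 < 1/16 * sqrt (k / (6 + 2 * ln (1 / k)))"
    by (simp add: add_pos_nonneg)
  then show "\<exists>c'>0::real. \<forall>n\<ge>1. \<forall>f \<in> cube n \<rightarrow> {0, 1}.
      expect n f \<le> 1 / 2 \<and> fourier_noise_resistant n c\<^sub>0 f \<longrightarrow>
      (\<exists>g. halfspace n g \<and> Cov n f g \<ge> c' * expect n f)"
    using constant_correlation_of_noise_resistant[OF _ _ _ k] by blast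
qed

end
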